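(* Let $k>s>t$ be real numbers with $k>0$ and $k+st\neq 0$. Suppose there exists a symmetric association scheme with 7 classes whose first and second eigenmatrices (for some ordering $A_0,\dots,A_7$ of the adjacency matrices and $E_0,\dots,E_7$ of the primitive idempotents) are $$P=\begin{pmatrix} 1 & 1 & 2 k & -\frac{2 k (s+1) (t+1)}{k+s t} & 2 & k & k & -\frac{2 k (s+1) (t+1)}{k+s t} \\ 1 & 1 & 2 k & -\frac{2 k (s+1) (t+1)}{k+s t} & -2 & -k & -k & \frac{2 k (s+1) (t+1)}{k+s t} \\ 1 & 1 & 2 s & -2 (s+1) & 2 & s & s & -2 (s+1) \\ 1 & 1 & 2 s & -2 (s+1) & -2 & -s & -s & 2 (s+1) \\ 1 & 1 & 2 t & -2 (t+1) & 2 & t & t & -2 (t+1) \\ 1 & 1 & 2 t & -2 (t+1) & -2 & -t & -t & 2 (t+1) \\ 1 & -1 & 0 & 0 & 0 & \sqrt{k} & -\sqrt{k} & 0 \\ 1 & -1 & 0 & 0 & 0 & -\sqrt{k} & \sqrt{k} & 0 \end{pmatrix},$$ $$Q=\begin{pmatrix} 1 & 1 & \frac{k (k-t) (t+1)}{(t-s) (k+s t)} & \frac{k (k-t) (t+1)}{(t-s) (k+s t)} & \frac{k (k-s) (s+1)}{(s-t) (k+s t)} & \frac{k (k-s) (s+1)}{(s-t) (k+s t)} & \frac{(k-s) (k-t)}{k+s t} & \frac{(k-s) (k-t)}{k+s t} \\ 1 & 1 & \frac{k (k-t) (t+1)}{(t-s) (k+s t)} & \frac{k (k-t) (t+1)}{(t-s)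 (k+s t)} & \frac{k (k-s) (s+1)}{(s-t) (k+s t)} & \frac{k (k-s) (s+1)}{(s-t) (k+s t)} & -\frac{(k-s) (k-t)}{k+s t} & -\frac{(k-s) (k-t)}{k+s t} \\ 1 & 1 & \frac{s (t+1) (t-k)}{(s-t) (k+s t)} & \frac{s (t+1) (t-k)}{(s-t) (k+s t)} & \frac{(k-s) (s+1) t}{(s-t) (k+s t)} & \frac{(k-s) (s+1) t}{(s-t) (k+s t)} & 0 & 0 \\ 1 & 1 & \frac{t-k}{s-t} & \frac{t-k}{s-t} & \frac{k-s}{s-t} & \frac{k-s}{s-t} & 0 & 0 \\ 1 & -1 & \frac{k (k-t) (t+1)}{(t-s) (k+s t)} & \frac{k (k-t) (t+1)}{(s-t) (k+s t)} & \frac{k (k-s) (s+1)}{(s-t) (k+s t)} & -\frac{k (k-s) (s+1)}{(s-t) (k+s t)} & 0 & 0 \\ 1 & -1 & \frac{s (t+1) (t-k)}{(s-t) (k+s t)} & \frac{s (k-t) (t+1)}{(s-t) (k+s t)} & \frac{(k-s) (s+1) t}{(s-t) (k+s t)} & -\frac{(k-s) (s+1) t}{(s-t) (k+s t)} & \frac{(k-s) (k-t)}{\sqrt{k} (k+s t)} & -\frac{(k-s) (k-t)}{\sqrt{k} (k+s t)} \\ 1 & -1 & \frac{s (t+1) (t-k)}{(s-t) (k+s t)} & \frac{s (k-t) (t+1)}{(s-t) (k+s t)} & \frac{(k-s) (s+1) t}{(s-t) (k+s t)} & -\frac{(k-s) (s+1) t}{(s-t) (k+s t)} & -\frac{(k-s)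 (k-t)}{\sqrt{k} (k+s t)} & \frac{(k-s) (k-t)}{\sqrt{k} (k+s t)} \\ 1 & -1 & \frac{t-k}{s-t} & \frac{k-t}{s-t} & \frac{k-s}{s-t} & \frac{s-k}{s-t} & 0 & 0 \end{pmatrix}.$$ Then there exists a quasi-balanced weighing matrix $W$ such that $|W|$ is the adjacency matrix of a strongly regular graph with parameters $(v,k,\lambda,\mu)$, where $v=\frac{(k-s)(k-t)}{k+st}$, $\lambda=k+s+t+st$, $\mu=k+st$.
   Context: A weighing matrix of order $v$ and weight $k$ is a $v\times v$ matrix $W$ with entries in $\{0,1,-1\}$ satisfying $WW^\top=kI_v$. $|W|$ is its entrywise absolute value. $W$ is quasi-balanced if $|W|\,|W|^\top=|W|^\top|W|$ and the off-diagonal entries of $|W|\,|W|^\top$ take at most two distinct values. A graph (simple, undirected) on $v$ vertices with adjacency matrix $A$ is strongly regular with parameters $(v,k,\lambda,\mu)$ if $A^2=kI_v+\lambda A+\mu(J_v-I_v-A)$, where $J_v$ is the all-ones matrix. A symmetric association scheme with $d$ classes on a finite set $X$ is a set of nonzero $(0,1)$-matrices $A_0,\dots,A_d$ indexed by $X$ with $A_0=I$, $\sum_i A_i=J$, $A_i^\top=A_i$, and $A_iA_j=\sum_{h} p_{ij}^hA_h$ for non-negative integers $p_{ij}^h$. Its Bose–Mesner algebra (the complex span of the $A_i$) has a basis of primitive idempotents $E_0=\frac1{|X|}J,E_1,\dots,E_d$, and the first and second eigenmatrices $P,Q$ (rows and columns indexed from $0$ to $d$) are defined by $A_j=\sum_i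 P_{ij}E_i$ and $E_j=\frac1{|X|}\sum_i Q_{ij}A_i$. *)

theory Defs
  imports Complex_Main "Jordan_Normal_Form.Matrix"
begin

definition all_ones_mat :: "nat \<Rightarrow> 'a :: one mat" where
  "all_ones_mat n = mat n n (\<lambda>_. 1)"

definition abs_mat :: "int mat \<Rightarrow> int mat" where
  "abs_mat W = map_mat abs W"

definition weighing_matrix :: "nat \<Rightarrow> nat \<Rightarrow> int mat \<Rightarrow> bool" where
  "weighing_matrix v k W \<longleftrightarrow>
     W \<in> carrier_mat v v \<and> elements_mat W \<subseteq> {0, 1, -1} \<and>
     W * W\<^sup>T = int k \<cdot>\<^sub>m 1\<^sub>m v"

definition quasi_balanced :: "nat \<Rightarrow> int mat \<Rightarrow> bool" where
  "quasi_balanced v W \<longleftrightarrow>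
     abs_mat W * (abs_mat W)\<^sup>T = (abs_mat W)\<^sup>T * abs_mat W \<and>
     card {(abs_mat W * (abs_mat W)\<^sup>T) $$ (i, j) | i j. i < v \<and> j < v \<and> i \<noteq> j} \<le> 2"

definition simple_graph :: "nat \<Rightarrow> nat set set \<Rightarrow> bool" where
  "simple_graph v E \<longleftrightarrow> E \<subseteq> {{x, y} | x y. x < v \<and> y < v \<and> x \<noteq> y}"

definition adjacency_mat :: "nat \<Rightarrow> nat set set \<Rightarrow> int mat" where
  "adjacency_mat v E = mat v v (\<lambda>(x, y). if {x, y} \<in> E then 1 else 0)"

definition strongly_regular :: "nat set set \<Rightarrow> nat \<Rightarrow> nat \<Rightarrow> nat \<Rightarrow> nat \<Rightarrow> bool" where
  "strongly_regular E v k l m \<longleftrightarrow> simple_graph v E \<and>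
     (let A = adjacency_mat v E in
      A * A = int k \<cdot>\<^sub>m 1\<^sub>m v + int l \<cdot>\<^sub>m A + int m \<cdot>\<^sub>m (all_ones_mat v - 1\<^sub>m v - A))"

text \<open>The linear combination of the \<open>n \<times> n\<close> matrices \<open>M 0, \<dots>, M d\<close> with coefficients
  \<open>c 0, \<dots>, c d\<close>. It is written entrywise because the type of matrices of arbitrary size is
  not an additive monoid.\<close>

definition lincomb_mat ::
    "nat \<Rightarrow> nat \<Rightarrow> (nat \<Rightarrow> complex) \<Rightarrow> (nat \<Rightarrow> complex mat) \<Rightarrow> complex mat" where
  "lincomb_mat n d c M = mat n n (\<lambda>(x, y). \<Sum>i\<le>d. c i * M i $$ (x, y))"

text \<open>The underlying finite set of a scheme is \<open>{0..<n}\<close>.\<close>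

definition symmetric_association_scheme :: "nat \<Rightarrow> nat \<Rightarrow> (nat \<Rightarrow> complex mat) \<Rightarrow> bool" where
  "symmetric_association_scheme n d A \<longleftrightarrow>
     (\<forall>i\<le>d. A i \<in> carrier_mat n n \<and> A i \<noteq> 0\<^sub>m n n \<and> elements_mat (A i) \<subseteq> {0, 1}) \<and>
     A 0 = 1\<^sub>m n \<and>
     lincomb_mat n d (\<lambda>_. 1) A = all_ones_mat n \<and>
     (\<forall>i\<le>d. (A i)\<^sup>T = A i) \<and>
     (\<exists>p :: nat \<Rightarrow> nat \<Rightarrow> nat \<Rightarrow> nat. \<forall>i\<le>d. \<forall>j\<le>d.
        A i * A j = lincomb_mat n d (\<lambda>h. of_nat (p i j h)) A)"

definition bose_mesner_algebra :: "nat \<Rightarrow> nat \<Rightarrow> (nat \<Rightarrow> complex mat) \<Rightarrow> complex mat set" where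
  "bose_mesner_algebra n d A = {lincomb_mat n d c A | c. True}"

text \<open>A nonzero idempotent of an algebra \<open>\<A>\<close> of \<open>n \<times> n\<close> matrices is primitive if it is
  not a sum of two nonzero orthogonal idempotents of \<open>\<A>\<close>.\<close>

definition primitive_idempotent :: "nat \<Rightarrow> complex mat set \<Rightarrow> complex mat \<Rightarrow> bool" where
  "primitive_idempotent n \<A> e \<longleftrightarrow>
     e \<in> \<A> \<and> e \<noteq> 0\<^sub>m n n \<and> e * e = e \<and>
     (\<forall>f\<in>\<A>. \<forall>g\<in>\<A>. f * f = f \<and> g * g = g \<and> f * g = 0\<^sub>m n n \<and> g * f = 0\<^sub>m n n \<and> e = f + g
        \<longrightarrow> f = 0\<^sub>m n n \<or> g = 0\<^sub>m n n)"

text \<open>\<open>E 0, \<dots>, E d\<close> lists every primitive idempotent of the Bose--Mesner algebra exactly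
  once, starting with \<open>J / n\<close>. That they form a basis of the algebra is a theorem and not part
  of the definition.\<close>

definition primitive_idempotents_ordering ::
    "nat \<Rightarrow> nat \<Rightarrow> (nat \<Rightarrow> complex mat) \<Rightarrow> (nat \<Rightarrow> complex mat) \<Rightarrow> bool" where
  "primitive_idempotents_ordering n d A E \<longleftrightarrow>
     bij_betw E {..d} {e. primitive_idempotent n (bose_mesner_algebra n d A) e} \<and>
     E 0 = (1 / of_nat n) \<cdot>\<^sub>m all_ones_mat n"

definition first_eigenmatrix ::
    "nat \<Rightarrow> nat \<Rightarrow> (nat \<Rightarrow> complex mat) \<Rightarrow> (nat \<Rightarrow> complex mat) \<Rightarrow> complex mat \<Rightarrow> bool" where
  "first_eigenmatrix n d A E P \<longleftrightarrow> P \<in> carrier_mat (d + 1) (d + 1) \<and>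
     (\<forall>j\<le>d. A j = lincomb_mat n d (\<lambda>i. P $$ (i, j)) E)"

definition second_eigenmatrix ::
    "nat \<Rightarrow> nat \<Rightarrow> (nat \<Rightarrow> complex mat) \<Rightarrow> (nat \<Rightarrow> complex mat) \<Rightarrow> complex mat \<Rightarrow> bool" where
  "second_eigenmatrix n d A E Q \<longleftrightarrow> Q \<in> carrier_mat (d + 1) (d + 1) \<and>
     (\<forall>j\<le>d. E j = (1 / of_nat n) \<cdot>\<^sub>m lincomb_mat n d (\<lambda>i. Q $$ (i, j)) A)"

definition P_mat :: "real \<Rightarrow> real \<Rightarrow> real \<Rightarrow> real mat" where
  "P_mat k s t = mat_of_rows_list 8
    [[1, 1, 2*k, - (2*k*(s+1)*(t+1) / (k+s*t)), 2, k, k, - (2*k*(s+1)*(t+1) / (k+s*t))],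
     [1, 1, 2*k, - (2*k*(s+1)*(t+1) / (k+s*t)), -2, -k, -k, 2*k*(s+1)*(t+1) / (k+s*t)],
     [1, 1, 2*s, -2*(s+1), 2, s, s, -2*(s+1)],
     [1, 1, 2*s, -2*(s+1), -2, -s, -s, 2*(s+1)],
     [1, 1, 2*t, -2*(t+1), 2, t, t, -2*(t+1)],
     [1, 1, 2*t, -2*(t+1), -2, -t, -t, 2*(t+1)],
     [1, -1, 0, 0, 0, sqrt k, - sqrt k, 0],
     [1, -1, 0, 0, 0, - sqrt k, sqrt k, 0]]"

definition Q_mat :: "real \<Rightarrow> real \<Rightarrow> real \<Rightarrow> real mat" where
  "Q_mat k s t = mat_of_rows_list 8
    [[1, 1,
      k*(k-t)*(t+1) / ((t-s)*(k+s*t)), k*(k-t)*(t+1) / ((t-s)*(k+s*t)),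
      k*(k-s)*(s+1) / ((s-t)*(k+s*t)), k*(k-s)*(s+1) / ((s-t)*(k+s*t)),
      (k-s)*(k-t) / (k+s*t), (k-s)*(k-t) / (k+s*t)],
     [1, 1,
      k*(k-t)*(t+1) / ((t-s)*(k+s*t)), k*(k-t)*(t+1) / ((t-s)*(k+s*t)),
      k*(k-s)*(s+1) / ((s-t)*(k+s*t)), k*(k-s)*(s+1) / ((s-t)*(k+s*t)),
      - ((k-s)*(k-t) / (k+s*t)), - ((k-s)*(k-t) / (k+s*t))],
     [1, 1,
      s*(t+1)*(t-k) / ((s-t)*(k+s*t)), s*(t+1)*(t-k) / ((s-t)*(k+s*t)),
      (k-s)*(s+1)*t / ((s-t)*(k+s*t)), (k-s)*(s+1)*t / ((s-t)*(k+s*t)),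
      0, 0],
     [1, 1,
      (t-k) / (s-t), (t-k) / (s-t),
      (k-s) / (s-t), (k-s) / (s-t),
      0, 0],
     [1, -1,
      k*(k-t)*(t+1) / ((t-s)*(k+s*t)), k*(k-t)*(t+1) / ((s-t)*(k+s*t)),
      k*(k-s)*(s+1) / ((s-t)*(k+s*t)), - (k*(k-s)*(s+1) / ((s-t)*(k+s*t))),
      0, 0],
     [1, -1,
      s*(t+1)*(t-k) / ((s-t)*(k+s*t)), s*(k-t)*(t+1) / ((s-t)*(k+s*t)),
      (k-s)*(s+1)*t / ((s-t)*(k+s*t)), - ((k-s)*(s+1)*t / ((s-t)*(k+s*t))),
      (k-s)*(k-t) / (sqrt k*(k+s*t)), - ((k-s)*(k-t) / (sqrt k*(k+s*t)))],
     [1, -1,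
      s*(t+1)*(t-k) / ((s-t)*(k+s*t)), s*(k-t)*(t+1) / ((s-t)*(k+s*t)),
      (k-s)*(s+1)*t / ((s-t)*(k+s*t)), - ((k-s)*(s+1)*t / ((s-t)*(k+s*t))),
      - ((k-s)*(k-t) / (sqrt k*(k+s*t))), (k-s)*(k-t) / (sqrt k*(k+s*t))],
     [1, -1,
      (t-k) / (s-t), (k-t) / (s-t),
      (k-s) / (s-t), (s-k) / (s-t),
      0, 0]]"

end

theory Submission
  imports Defs
begin

text \<open>
  Let \<open>R = A\<^sub>0 + A\<^sub>1 + A\<^sub>2 + A\<^sub>3\<close>. Comparing rows of \<open>P\<close> gives all products needed:
  \<open>R\<^sup>2 = (A\<^sub>4 + A\<^sub>5 + A\<^sub>6 + A\<^sub>7)\<^sup>2 = 2v R\<close>, so \<open>R\<close> splits the points into two halves;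
  \<open>A\<^sub>1\<^sup>2 = I\<close>, so \<open>A\<^sub>1\<close> is a fixed-point-free involution pairing up the points of each half; and
  \<open>A\<^sub>4\<^sup>2 = 2(I + A\<^sub>1)\<close>, so \<open>A\<^sub>4\<close> matches the pairs of one half with those of the other.
  Choose one representative of each pair in one half and a matched representative of each pair in
  the other, and let \<open>W\<close> be the block of \<open>A\<^sub>5 - A\<^sub>6\<close> with these rows and columns. As
  \<open>A\<^sub>1 (A\<^sub>5 - A\<^sub>6) = -(A\<^sub>5 - A\<^sub>6)\<close> and \<open>(A\<^sub>5 - A\<^sub>6)\<^sup>2 = 2k(I - A\<^sub>1)\<close>, \<open>W\<close> is a weighing matrix.
  As \<open>A\<^sub>4 (A\<^sub>5 + A\<^sub>6) = 2A\<^sub>2\<close>, \<open>|W|\<close> is the block of \<open>A\<^sub>2\<close> on the chosen representatives, and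
  \<open>A\<^sub>2\<^sup>2 = 2k(I + A\<^sub>1) + 2\<lambda>A\<^sub>2 + 2\<mu>A\<^sub>3\<close> is the strongly regular identity doubled.
  The integrality of \<open>k\<close>, \<open>\<lambda>\<close>, \<open>\<mu>\<close> follows by counting, since \<open>A\<^sub>2\<close> and \<open>A\<^sub>3\<close> are nonzero.
\<close>

section \<open>The Bose--Mesner algebra\<close>

lemma lincomb_mat_carrier [simp]: "lincomb_mat n d c M \<in> carrier_mat n n"
  by (simp add: lincomb_mat_def)

lemma dim_lincomb_mat [simp]:
  "dim_row (lincomb_mat n d c M) = n" "dim_col (lincomb_mat n d c M) = n"
  by (simp_all add: lincomb_mat_def)

lemma lincomb_mat_index:
  "x < n \<Longrightarrow> y < n \<Longrightarrow> lincomb_mat n d c M $$ (x, y) = (\<Sum>i\<le>d. c i * M i $$ (x, y))"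
  by (simp add: lincomb_mat_def)

lemma mat_mult_index:
  assumes "A \<in> carrier_mat n n" "B \<in> carrier_mat n n" "x < n" "y < n"
  shows "(A * B) $$ (x, y) = (\<Sum>z<n. A $$ (x, z) * B $$ (z, y))"
  using assms by (simp add: scalar_prod_def lessThan_atLeast0)

lemma lincomb_mat_mult_index:
  assumes "\<And>i. i \<le> d \<Longrightarrow> M i \<in> carrier_mat n n" "\<And>i. i \<le> d \<Longrightarrow> N i \<in> carrier_mat n n"
    and "x < n" "y < n"
  shows "(lincomb_mat n d b M * lincomb_mat n d c N) $$ (x, y)
       = (\<Sum>i\<le>d. \<Sum>j\<le>d. b i * c j * (M i * N j) $$ (x, y))"
proof -
  have "(lincomb_mat n d b M * lincomb_mat n d c N) $$ (x, y)
      = (\<Sum>z<n. (\<Sum>i\<le>d. b i * M i $$ (x, z)) * (\<Sum>j\<le>d. c j * N j $$ (z, y)))"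
    using assms(3,4) by (simp add: mat_mult_index[where n = n] lincomb_mat_index del: index_mult_mat)
  also have "\<dots> = (\<Sum>z<n. \<Sum>i\<le>d. \<Sum>j\<le>d. b i * c j * (M i $$ (x, z) * N j $$ (z, y)))"
    by (simp add: sum_product mult_ac)
  also have "\<dots> = (\<Sum>i\<le>d. \<Sum>z<n. \<Sum>j\<le>d. b i * c j * (M i $$ (x, z) * N j $$ (z, y)))"
    by (rule sum.swap)
  also have "\<dots> = (\<Sum>i\<le>d. \<Sum>j\<le>d. \<Sum>z<n. b i * c j * (M i $$ (x, z) * N j $$ (z, y)))"
    by (intro sum.cong refl sum.swap)
  also have "\<dots> = (\<Sum>i\<le>d. \<Sum>j\<le>d. b i * c j * (M i * N j) $$ (x, y))"
    using assms by (intro sum.cong refl)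
      (simp add: mat_mult_index[where n = n] sum_distrib_left del: index_mult_mat)
  finally show ?thesis .
qed

lemma scheme_carrier:
  "symmetric_association_scheme n d A \<Longrightarrow> i \<le> d \<Longrightarrow> A i \<in> carrier_mat n n"
  by (simp add: symmetric_association_scheme_def)

lemma bose_mesner_carrier: "e \<in> bose_mesner_algebra n d A \<Longrightarrow> e \<in> carrier_mat n n"
  by (auto simp: bose_mesner_algebra_def)

lemma bose_mesner_mult:
  assumes sch: "symmetric_association_scheme n d A"
    and "e \<in> bose_mesner_algebra n d A" "f \<in> bose_mesner_algebra n d A"
  shows "e * f \<in> bose_mesner_algebra n d A"
proof -
  obtain b c where e: "e = lincomb_mat n d b A" and f: "f = lincomb_mat n d c A"
    using assms(2,3) by (auto simp: bose_mesner_algebra_def)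
  obtain p :: "nat \<Rightarrow> nat \<Rightarrow> nat \<Rightarrow> nat"
    where p: "\<And>i j. i \<le> d \<Longrightarrow> j \<le> d \<Longrightarrow> A i * A j = lincomb_mat n d (\<lambda>h. of_nat (p i j h)) A"
    using sch unfolding symmetric_association_scheme_def by blast
  \<comment> \<open>Expanding each \<open>A i * A j\<close> by the intersection numbers,
    \<open>?q h\<close> collects the coefficient of \<open>A h\<close>.\<close>
  let ?q = "\<lambda>h. \<Sum>i\<le>d. \<Sum>j\<le>d. b i * c j * of_nat (p i j h)"
  have "e * f = lincomb_mat n d ?q A"
  proof (rule eq_matI)
    fix x y assume "x < dim_row (lincomb_mat n d ?q A)" "y < dim_col (lincomb_mat n d ?q A)"
    hence xy: "x < n" "y < n" by auto
    have "(e * f) $$ (x, y) = (\<Sum>i\<le>d. \<Sum>j\<le>d. b i * c j * (A i * A j) $$ (x, y))"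
      unfolding e f by (rule lincomb_mat_mult_index) (use sch xy scheme_carrier in auto)
    also have "\<dots> = (\<Sum>i\<le>d. \<Sum>j\<le>d. \<Sum>h\<le>d. b i * c j * of_nat (p i j h) * A h $$ (x, y))"
      using xy by (simp add: p lincomb_mat_index sum_distrib_left mult.assoc
        del: index_mult_mat)
    also have "\<dots> = (\<Sum>i\<le>d. \<Sum>h\<le>d. \<Sum>j\<le>d. b i * c j * of_nat (p i j h) * A h $$ (x, y))"
      by (intro sum.cong refl sum.swap)
    also have "\<dots> = (\<Sum>h\<le>d. \<Sum>i\<le>d. \<Sum>j\<le>d. b i * c j * of_nat (p i j h) * A h $$ (x, y))"
      by (rule sum.swap)
    also have "\<dots> = lincomb_mat n d ?q A $$ (x, y)"
      using xy by (simp add: lincomb_mat_index sum_distrib_right)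
    finally show "(e * f) $$ (x, y) = lincomb_mat n d ?q A $$ (x, y)" .
  qed (simp_all add: e f)
  thus ?thesis by (auto simp: bose_mesner_algebra_def)
qed

lemma bose_mesner_diff:
  assumes "symmetric_association_scheme n d A"
    and "e \<in> bose_mesner_algebra n d A" "f \<in> bose_mesner_algebra n d A"
  shows "e - f \<in> bose_mesner_algebra n d A"
proof -
  obtain b c where e: "e = lincomb_mat n d b A" and f: "f = lincomb_mat n d c A"
    using assms(2,3) by (auto simp: bose_mesner_algebra_def)
  have "e - f = lincomb_mat n d (\<lambda>i. b i - c i) A"
    by (rule eq_matI) (simp_all add: e f lincomb_mat_index sum_subtractf left_diff_distrib)
  thus ?thesis by (auto simp: bose_mesner_algebra_def)
qed

lemma bose_mesner_transpose:
  assumes sch: "symmetric_association_scheme n d A" and "e \<in> bose_mesner_algebra n d A"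
  shows "e\<^sup>T = e"
proof -
  obtain b where e: "e = lincomb_mat n d b A"
    using assms(2) by (auto simp: bose_mesner_algebra_def)
  have "A i $$ (y, x) = A i $$ (x, y)" if "i \<le> d" "x < n" "y < n" for i x y
  proof -
    have "(A i)\<^sup>T = A i" using sch that(1) by (simp add: symmetric_association_scheme_def)
    thus ?thesis
      using index_transpose_mat(1)[of x "A i" y] scheme_carrier[OF sch that(1)] that(2,3) by auto
  qed
  thus ?thesis
    by (intro eq_matI) (auto simp: e lincomb_mat_index)
qed

text \<open>The product lies in the algebra again, so it is symmetric, and transposing it reverses
  the factors.\<close>

lemma bose_mesner_commute:
  assumes "symmetric_association_scheme n d A"
    and "e \<in> bose_mesner_algebra n d A" "f \<in> bose_mesner_algebra n d A"
  shows "e * f = f * e"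
  using bose_mesner_transpose[OF assms(1)] bose_mesner_mult[OF assms]
    transpose_mult[OF bose_mesner_carrier[OF assms(2)] bose_mesner_carrier[OF assms(3)]] assms(2,3)
  by metis

section \<open>Orthogonality of the primitive idempotents\<close>

lemma primitive_idempotent_absorb:
  assumes sch: "symmetric_association_scheme n d A"
    and e: "primitive_idempotent n (bose_mesner_algebra n d A) e"
    and f: "f \<in> bose_mesner_algebra n d A" "f * f = f"
  shows "e * f = 0\<^sub>m n n \<or> e * f = e"
proof -
  have eA: "e \<in> bose_mesner_algebra n d A" and ee: "e * e = e"
    using e by (auto simp: primitive_idempotent_def)
  note [simp] = bose_mesner_carrier[OF eA] bose_mesner_carrier[OF f(1)]
  \<comment> \<open>\<open>g\<close> and \<open>e - g\<close> are orthogonal idempotents with sum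
    \<open>e\<close>, so primitivity of \<open>e\<close> makes one of them vanish.\<close>
  define g where "g = e * f"
  have gA: "g \<in> bose_mesner_algebra n d A"
    unfolding g_def by (rule bose_mesner_mult[OF sch eA f(1)])
  note [simp] = bose_mesner_carrier[OF gA] carrier_matD[OF bose_mesner_carrier[OF eA]]
    carrier_matD[OF bose_mesner_carrier[OF gA]]
  have hA: "e - g \<in> bose_mesner_algebra n d A" by (rule bose_mesner_diff[OF sch eA gA])
  have eg: "e * g = g"
    using assoc_mult_mat[of e n n e n f n] by (simp add: g_def ee)
  have ge: "g * e = g" using bose_mesner_commute[OF sch gA eA] eg by simp
  have gf: "g * f = g"
    using assoc_mult_mat[of e n n f n f n] by (simp add: g_def f(2))
  have gg: "g * g = g"
    using assoc_mult_mat[of g n n e n f n] by (simp add: g_def[symmetric] ge gf)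
  have gh: "g * (e - g) = 0\<^sub>m n n"
    using mult_minus_distrib_mat[of g n n e n g] by (simp add: ge gg minus_r_inv_mat)
  have hg: "(e - g) * g = 0\<^sub>m n n"
    using bose_mesner_commute[OF sch gA hA] gh by simp
  have "e - g - 0\<^sub>m n n = e - g"
    by (rule eq_matI) auto
  hence hh: "(e - g) * (e - g) = e - g"
    using minus_mult_distrib_mat[of e n n g "e - g" n] mult_minus_distrib_mat[of e n n e n g]
      bose_mesner_carrier[OF hA]
    by (simp add: gh ee eg)
  have "e = g + (e - g)" by (rule eq_matI) auto
  hence "g = 0\<^sub>m n n \<or> e - g = 0\<^sub>m n n"
    using e gA hA gg hh gh hg unfolding primitive_idempotent_def by blast
  moreover have "g = e" if z: "e - g = 0\<^sub>m n n"
  proof (rule eq_matI)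
    fix i j assume "i < dim_row e" "j < dim_col e"
    moreover from this have "(e - g) $$ (i, j) = 0" by (simp add: z)
    ultimately show "g $$ (i, j) = e $$ (i, j)" by simp
  qed auto
  ultimately show ?thesis unfolding g_def by blast
qed

text \<open>By absorption from both sides, a nonzero product would equal both \<open>e\<close> and
  \<open>f\<close>.\<close>

lemma primitive_idempotent_orthogonal:
  assumes sch: "symmetric_association_scheme n d A"
    and e: "primitive_idempotent n (bose_mesner_algebra n d A) e"
    and f: "primitive_idempotent n (bose_mesner_algebra n d A) f"
    and "e \<noteq> f"
  shows "e * f = 0\<^sub>m n n"
  using primitive_idempotent_absorb[OF sch e, of f] primitive_idempotent_absorb[OF sch f, of e]
    bose_mesner_commute[OF sch, of e f] e f \<open>e \<noteq> f\<close>
  unfolding primitive_idempotent_def by metis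

lemma lincomb_idempotents_mult:
  assumes sch: "symmetric_association_scheme n d A"
    and ord: "primitive_idempotents_ordering n d A E"
  shows "lincomb_mat n d b E * lincomb_mat n d c E = lincomb_mat n d (\<lambda>i. b i * c i) E"
proof (rule eq_matI)
  have prim: "primitive_idempotent n (bose_mesner_algebra n d A) (E i)" if "i \<le> d" for i
    using ord that unfolding primitive_idempotents_ordering_def bij_betw_def by blast
  have inj: "inj_on E {..d}"
    using ord unfolding primitive_idempotents_ordering_def bij_betw_def by blast
  have EE: "E i * E j = (if i = j then E i else 0\<^sub>m n n)" if "i \<le> d" "j \<le> d" for i j
    using primitive_idempotent_orthogonal[OF sch prim prim, of i j] that inj prim[of i]
    by (auto simp: inj_on_eq_iff primitive_idempotent_def)
  have carr: "E i \<in> carrier_mat n n" if "i \<le> d" for i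
    using prim[OF that] bose_mesner_carrier by (auto simp: primitive_idempotent_def)
  fix x y assume "x < dim_row (lincomb_mat n d (\<lambda>i. b i * c i) E)"
    "y < dim_col (lincomb_mat n d (\<lambda>i. b i * c i) E)"
  hence xy: "x < n" "y < n" by auto
  have "(lincomb_mat n d b E * lincomb_mat n d c E) $$ (x, y)
      = (\<Sum>i\<le>d. \<Sum>j\<le>d. b i * c j * (E i * E j) $$ (x, y))"
    by (rule lincomb_mat_mult_index) (use carr xy in auto)
  also have "\<dots> = (\<Sum>i\<le>d. \<Sum>j\<le>d. if j = i then b i * c i * E i $$ (x, y) else 0)"
    using xy by (intro sum.cong refl) (auto simp: EE simp del: index_mult_mat)
  also have "\<dots> = lincomb_mat n d (\<lambda>i. b i * c i) E $$ (x, y)"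
    using xy by (simp add: lincomb_mat_index)
  finally show "(lincomb_mat n d b E * lincomb_mat n d c E) $$ (x, y) = \<dots>" .
qed simp_all

lemma lincomb_mat_eigenmatrix:
  assumes P: "first_eigenmatrix n d A E P"
  shows "lincomb_mat n d c A = lincomb_mat n d (\<lambda>i. \<Sum>j\<le>d. c j * P $$ (i, j)) E"
proof (rule eq_matI)
  fix x y assume "x < dim_row (lincomb_mat n d (\<lambda>i. \<Sum>j\<le>d. c j * P $$ (i, j)) E)"
    "y < dim_col (lincomb_mat n d (\<lambda>i. \<Sum>j\<le>d. c j * P $$ (i, j)) E)"
  hence xy: "x < n" "y < n" by auto
  have "lincomb_mat n d c A $$ (x, y)
      = (\<Sum>j\<le>d. c j * lincomb_mat n d (\<lambda>i. P $$ (i, j)) E $$ (x, y))"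
    using P unfolding lincomb_mat_index[OF xy, of d c] first_eigenmatrix_def by simp
  also have "\<dots> = (\<Sum>j\<le>d. \<Sum>i\<le>d. c j * P $$ (i, j) * E i $$ (x, y))"
    using xy by (simp add: lincomb_mat_index sum_distrib_left mult.assoc)
  also have "\<dots> = (\<Sum>i\<le>d. \<Sum>j\<le>d. c j * P $$ (i, j) * E i $$ (x, y))"
    by (rule sum.swap)
  also have "\<dots> = lincomb_mat n d (\<lambda>i. \<Sum>j\<le>d. c j * P $$ (i, j)) E $$ (x, y)"
    using xy by (simp add: lincomb_mat_index sum_distrib_right)
  finally show "lincomb_mat n d c A $$ (x, y) = \<dots>" .
qed simp_all

text \<open>In the coordinates given by \<open>E\<close>, multiplication is pointwise. A product
  identity thus reduces to one scalar equation between eigenvalues for each row of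
  \<open>P\<close>.\<close>

lemma lincomb_scheme_mult:
  assumes "symmetric_association_scheme n d A" "primitive_idempotents_ordering n d A E"
    and P: "first_eigenmatrix n d A E P"
    and eq: "\<And>i. i \<le> d \<Longrightarrow> (\<Sum>j\<le>d. b j * P $$ (i, j)) * (\<Sum>j\<le>d. c j * P $$ (i, j))
                      = (\<Sum>j\<le>d. g j * P $$ (i, j))"
  shows "lincomb_mat n d b A * lincomb_mat n d c A = lincomb_mat n d g A"
  unfolding lincomb_mat_eigenmatrix[OF P] lincomb_idempotents_mult[OF assms(1,2)]
  by (rule eq_matI) (auto simp: lincomb_mat_index eq)

section \<open>The fourfold structure of the scheme\<close>

lemma sum_atMost_7: "(\<Sum>i\<le>7. f i) = f 0 + f 1 + f 2 + f 3 + f 4 + f 5 + f 6 + (f 7 :: real)"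
  for f :: "nat \<Rightarrow> real"
  by (simp add: eval_nat_numeral)

text \<open>A single intermediate point makes an entry of a product positive. The product formulas
  then tell how the two end points are related.\<close>

lemma sum_mult_ge_1:
  fixes f g :: "nat \<Rightarrow> real"
  assumes "z < n" "f z = 1" "g z = 1"
    and "\<And>w. w < n \<Longrightarrow> f w \<ge> 0" "\<And>w. w < n \<Longrightarrow> g w \<ge> 0"
  shows "(\<Sum>w<n. f w * g w) \<ge> 1"
proof -
  have "f z * g z \<le> (\<Sum>w<n. f w * g w)"
    using assms by (intro member_le_sum) auto
  thus ?thesis using assms by simp
qed

lemma sum_mult_ne_0D:
  fixes f g :: "nat \<Rightarrow> real"
  assumes "(\<Sum>z<n. f z * g z) \<noteq> 0"
  obtains z where "z < n" "f z \<noteq> 0" "g z \<noteq> 0"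
  using assms by (metis (no_types, lifting) lessThan_iff mult_eq_0_iff sum.neutral)

lemma mult_transpose_index:
  fixes A B :: "int mat"
  assumes "A \<in> carrier_mat n n" "B \<in> carrier_mat n n" "i < n" "j < n"
  shows "real_of_int ((A * B\<^sup>T) $$ (i, j)) = (\<Sum>q<n. real_of_int (A $$ (i, q)) * real_of_int (B $$ (j, q)))"
  using mat_mult_index[of A n "B\<^sup>T" i j] assms by (simp del: index_mult_mat)

text \<open>The real number \<open>a i x y\<close> is the entry of the \<open>i\<close>-th adjacency matrix; the assumption
  \<open>product\<close> says that the Bose--Mesner algebra multiplies through the rows of \<open>P\<close>.\<close>

locale fourfold_scheme =
  fixes n :: nat and k s t :: real and a :: "nat \<Rightarrow> nat \<Rightarrow> nat \<Rightarrow> real" and x0 y0 :: nat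
  assumes k_pos: "k > 0" and k_st: "k + s * t \<noteq> 0"
    and entries: "i \<le> 7 \<Longrightarrow> x < n \<Longrightarrow> y < n \<Longrightarrow> a i x y \<in> {0, 1}"
    and sum_entries: "x < n \<Longrightarrow> y < n \<Longrightarrow> (\<Sum>i\<le>7. a i x y) = 1"
    and identity: "x < n \<Longrightarrow> y < n \<Longrightarrow> a 0 x y = of_bool (x = y)"
    and sym: "i \<le> 7 \<Longrightarrow> x < n \<Longrightarrow> y < n \<Longrightarrow> a i x y = a i y x"
    and product: "(\<And>i. i \<le> 7 \<Longrightarrow> (\<Sum>j\<le>7. b j * P_mat k s t $$ (i, j)) * (\<Sum>j\<le>7. c j * P_mat k s t $$ (i, j))
          = (\<Sum>j\<le>7. g j * P_mat k s t $$ (i, j))) \<Longrightarrow> x < n \<Longrightarrow> y < n \<Longrightarrow>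
        (\<Sum>z<n. (\<Sum>i\<le>7. b i * a i x z) * (\<Sum>i\<le>7. c i * a i z y)) = (\<Sum>i\<le>7. g i * a i x y)"
    and base: "x0 < n" "y0 < n" "a 3 x0 y0 = 1"
begin

text \<open>Coefficient lists and an explicit index set let the simplifier evaluate all eight row
  equations.\<close>

lemma product_list:
  assumes "\<forall>i\<in>{0,1,2,3,4,5,6,7}.
      (\<Sum>j\<le>7. b ! j * P_mat k s t $$ (i, j)) * (\<Sum>j\<le>7. c ! j * P_mat k s t $$ (i, j))
          = (\<Sum>j\<le>7. g ! j * P_mat k s t $$ (i, j))"
    and "x < n" "y < n"
  shows "(\<Sum>z<n. (\<Sum>i\<le>7. b ! i * a i x z) * (\<Sum>i\<le>7. c ! i * a i z y)) = (\<Sum>i\<le>7. g ! i * a i x y)"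
proof (rule product[OF _ assms(2,3)])
  fix i :: nat assume "i \<le> 7"
  hence "i \<in> {0,1,2,3,4,5,6,7}" by auto
  thus "(\<Sum>j\<le>7. b ! j * P_mat k s t $$ (i, j)) * (\<Sum>j\<le>7. c ! j * P_mat k s t $$ (i, j))
          = (\<Sum>j\<le>7. g ! j * P_mat k s t $$ (i, j))"
    using assms(1) by blast
qed

text \<open>\<open>-c\<close> is v - 1 - k, the valency of the complement of the strongly regular
  graph; A_3 has valency \<open>-2*c\<close>.\<close>

definition c where "c = k * (s + 1) * (t + 1) / (k + s * t)"

definition v where "v = (k - s) * (k - t) / (k + s * t)"

lemma v_eq: "v = 1 + k - c"
  using k_st by (simp add: v_def c_def field_simps)

text \<open>With the quotient hidden in \<open>c\<close>, the row equations are free of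
  division.\<close>

lemma P_mat_eq:
  "P_mat k s t = mat_of_rows_list 8
    [[1, 1, 2*k, -2*c, 2, k, k, -2*c],
     [1, 1, 2*k, -2*c, -2, -k, -k, 2*c],
     [1, 1, 2*s, -2*(s+1), 2, s, s, -2*(s+1)],
     [1, 1, 2*s, -2*(s+1), -2, -s, -s, 2*(s+1)],
     [1, 1, 2*t, -2*(t+1), 2, t, t, -2*(t+1)],
     [1, 1, 2*t, -2*(t+1), -2, -t, -t, 2*(t+1)],
     [1, -1, 0, 0, 0, sqrt k, - sqrt k, 0],
     [1, -1, 0, 0, 0, - sqrt k, sqrt k, 0]]"
  by (simp add: P_mat_def c_def mult.assoc)

definition R where "R x y = a 0 x y + a 1 x y + a 2 x y + a 3 x y"
definition S where "S x y = a 4 x y + a 5 x y + a 6 x y + a 7 x y"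
text \<open>A_5 - A_6 carries the signs of the weighing matrix, A_5 + A_6 the absolute
  values.\<close>

definition M where "M x y = a 5 x y - a 6 x y"
definition N where "N x y = a 5 x y + a 6 x y"

lemmas product_simps = sum_atMost_7 P_mat_eq mat_of_rows_list_def

section \<open>Product formulas read off from the rows of P\<close>

lemma prod_1_1: "x < n \<Longrightarrow> y < n \<Longrightarrow> (\<Sum>z<n. a 1 x z * a 1 z y) = a 0 x y"
  using product_list[of "[0,1,0,0,0,0,0,0]" "[0,1,0,0,0,0,0,0]" "[1,0,0,0,0,0,0,0]" x y]
  by (simp add: product_simps)

lemma prod_1_2: "x < n \<Longrightarrow> y < n \<Longrightarrow> (\<Sum>z<n. a 1 x z * a 2 z y) = a 2 x y"
  using product_list[of "[0,1,0,0,0,0,0,0]" "[0,0,1,0,0,0,0,0]" "[0,0,1,0,0,0,0,0]" x y]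
  by (simp add: product_simps)

lemma prod_1_4: "x < n \<Longrightarrow> y < n \<Longrightarrow> (\<Sum>z<n. a 1 x z * a 4 z y) = a 4 x y"
  using product_list[of "[0,1,0,0,0,0,0,0]" "[0,0,0,0,1,0,0,0]" "[0,0,0,0,1,0,0,0]" x y]
  by (simp add: product_simps)

lemma prod_1_R: "x < n \<Longrightarrow> y < n \<Longrightarrow> (\<Sum>z<n. a 1 x z * R z y) = R x y"
  using product_list[of "[0,1,0,0,0,0,0,0]" "[1,1,1,1,0,0,0,0]" "[1,1,1,1,0,0,0,0]" x y]
  by (simp add: product_simps R_def)

text \<open>Columns 5 and 6 of P agree in rows 0 to 5, so \<open>M\<close> lives on E_6 and E_7,
  exactly where A_1 has eigenvalue -1.\<close>

lemma prod_1_M: "x < n \<Longrightarrow> y < n \<Longrightarrow> (\<Sum>z<n. a 1 x z * M z y) = - M x y"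
  using product_list[of "[0,1,0,0,0,0,0,0]" "[0,0,0,0,0,1,-1,0]" "[0,0,0,0,0,-1,1,0]" x y]
  by (simp add: product_simps M_def)

lemma prod_1_N: "x < n \<Longrightarrow> y < n \<Longrightarrow> (\<Sum>z<n. a 1 x z * N z y) = N x y"
  using product_list[of "[0,1,0,0,0,0,0,0]" "[0,0,0,0,0,1,1,0]" "[0,0,0,0,0,1,1,0]" x y]
  by (simp add: product_simps N_def)

text \<open>A_4 has eigenvalue 2 or -2 where A_1 has 1, and 0 where A_1 has -1.\<close>

lemma prod_4_4: "x < n \<Longrightarrow> y < n \<Longrightarrow> (\<Sum>z<n. a 4 x z * a 4 z y) = 2 * (a 0 x y + a 1 x y)"
  using product_list[of "[0,0,0,0,1,0,0,0]" "[0,0,0,0,1,0,0,0]" "[2,2,0,0,0,0,0,0]" x y]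
  by (simp add: product_simps)

text \<open>On E_0 to E_5 the eigenvalues of A_4 and \<open>N\<close> are 2 and that of A_2, up to a
  common sign that cancels. On E_6 and E_7 everything is 0.\<close>

lemma prod_4_N: "x < n \<Longrightarrow> y < n \<Longrightarrow> (\<Sum>z<n. a 4 x z * N z y) = 2 * a 2 x y"
  using product_list[of "[0,0,0,0,1,0,0,0]" "[0,0,0,0,0,1,1,0]" "[0,0,2,0,0,0,0,0]" x y]
  by (simp add: product_simps N_def)

lemma prod_M_M: "x < n \<Longrightarrow> y < n \<Longrightarrow> (\<Sum>z<n. M x z * M z y) = 2 * k * (a 0 x y - a 1 x y)"
  using product_list[of "[0,0,0,0,0,1,-1,0]" "[0,0,0,0,0,1,-1,0]" "[2*k,-2*k,0,0,0,0,0,0]" x y] k_pos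
  by (simp add: product_simps M_def algebra_simps)

text \<open>\<open>R\<close> has eigenvalue \<open>2*v\<close> on E_0 and E_1 and 0 elsewhere;
  \<open>S\<close> differs only by the sign on E_1, so its square is the same.\<close>

lemma prod_R_R:
  assumes "x < n" "y < n"
  shows "(\<Sum>z<n. R x z * R z y) = 2 * v * R x y"
proof -
  have "(2 + 2 * k - 2 * c) * (2 + 2 * k - 2 * c) = 2 * v * (2 + 2 * k - 2 * c)"
    by (simp add: v_eq)
  thus ?thesis
    using product_list[of "[1,1,1,1,0,0,0,0]" "[1,1,1,1,0,0,0,0]"
        "[2*v,2*v,2*v,2*v,0,0,0,0]" x y] assms
    by (simp add: product_simps R_def algebra_simps)
qed

lemma prod_S_S:
  assumes "x < n" "y < n"
  shows "(\<Sum>z<n. S x z * S z y) = 2 * v * R x y"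
proof -
  have "(2 + 2 * k - 2 * c) * (2 + 2 * k - 2 * c) = 2 * v * (2 + 2 * k - 2 * c)"
    by (simp add: v_eq)
  thus ?thesis
    using product_list[of "[0,0,0,0,1,1,1,1]" "[0,0,0,0,1,1,1,1]"
        "[2*v,2*v,2*v,2*v,0,0,0,0]" x y] assms
    by (simp add: product_simps R_def S_def algebra_simps)
qed

abbreviation l where "l \<equiv> k + s + t + s * t"
abbreviation m where "m \<equiv> k + s * t"

lemma prod_2_2:
  assumes "x < n" "y < n"
  shows "(\<Sum>z<n. a 2 x z * a 2 z y)
       = 2 * (k * (a 0 x y + a 1 x y) + l * a 2 x y + m * a 3 x y)"
proof -
  \<comment> \<open>This settles rows 0 and 1; for s and t the equation is a polynomial
    identity.\<close>
  have "m * c = k * (s + 1) * (t + 1)" using k_st by (simp add: c_def)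
  hence "2 * k * (2 * k) = 2 * k + 2 * k + 2 * l * (2 * k) - 2 * m * (2 * c)"
    by (simp add: algebra_simps)
  thus ?thesis
    using product_list[of "[0,0,1,0,0,0,0,0]" "[0,0,1,0,0,0,0,0]" "[2*k,2*k,2*l,2*m,0,0,0,0]" x y] assms
    by (simp add: product_simps algebra_simps)
qed

section \<open>The two halves\<close>

lemma a_01: "i \<le> 7 \<Longrightarrow> x < n \<Longrightarrow> y < n \<Longrightarrow> a i x y = 0 \<or> a i x y = 1"
  using entries by fastforce

lemma a_ge_0: "i \<le> 7 \<Longrightarrow> x < n \<Longrightarrow> y < n \<Longrightarrow> a i x y \<ge> 0"
  using a_01 by fastforce

lemma R_plus_S: "x < n \<Longrightarrow> y < n \<Longrightarrow> R x y + S x y = 1"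
  using sum_entries[of x y] by (simp add: sum_atMost_7 R_def S_def)

lemma entries_nonneg:
  assumes "x < n" "y < n"
  shows "a 0 x y \<ge> 0" "a 1 x y \<ge> 0" "a 2 x y \<ge> 0" "a 3 x y \<ge> 0"
    "a 4 x y \<ge> 0" "a 5 x y \<ge> 0" "a 6 x y \<ge> 0" "a 7 x y \<ge> 0"
  using assms by (simp_all add: a_ge_0)

lemma R_01: "x < n \<Longrightarrow> y < n \<Longrightarrow> R x y = 0 \<or> R x y = 1"
  using a_01[of 0 x y] a_01[of 1 x y] a_01[of 2 x y] a_01[of 3 x y]
    R_plus_S[of x y] entries_nonneg[of x y] unfolding R_def S_def by auto

lemma R_ge_0: "x < n \<Longrightarrow> y < n \<Longrightarrow> R x y \<ge> 0"
  using R_01[of x y] by auto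

lemma S_eq: "x < n \<Longrightarrow> y < n \<Longrightarrow> S x y = 1 - R x y"
  using R_plus_S[of x y] by simp

lemma R_eq_0D:
  assumes "x < n" "y < n" "R x y = 0"
  shows "a 2 x y = 0"
  using assms entries_nonneg[of x y] unfolding R_def by linarith

lemma R_eq_1D:
  assumes "x < n" "y < n" "R x y = 1"
  shows "a 4 x y = 0" "M x y = 0"
  using assms entries_nonneg[of x y] R_plus_S[of x y] unfolding S_def M_def by linarith+

lemma R_refl: "x < n \<Longrightarrow> R x x = 1"
  using R_01[of x x] identity[of x x] entries_nonneg[of x x] unfolding R_def by auto

lemma R_sym: "x < n \<Longrightarrow> y < n \<Longrightarrow> R x y = R y x"
  by (simp add: R_def sym[of _ x y])

lemma M_sym: "x < n \<Longrightarrow> y < n \<Longrightarrow> M x y = M y x"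
  by (simp add: M_def sym[of _ x y])

lemma N_sym: "x < n \<Longrightarrow> y < n \<Longrightarrow> N x y = N y x"
  by (simp add: N_def sym[of _ x y])

lemma M_cases: "x < n \<Longrightarrow> y < n \<Longrightarrow> M x y \<in> {-1, 0, 1}"
  using a_01[of 5 x y] a_01[of 6 x y] unfolding M_def by auto

lemma abs_M: "x < n \<Longrightarrow> y < n \<Longrightarrow> \<bar>M x y\<bar> = N x y"
  using a_01[of 5 x y] a_01[of 6 x y] R_plus_S[of x y] entries_nonneg[of x y]
  unfolding M_def N_def R_def S_def by auto

lemma R_trans:
  assumes "x < n" "y < n" "z < n" "R x y = 1" "R y z = 1"
  shows "R x z = 1"
proof -
  have "1 \<le> (\<Sum>w<n. R x w * R w z)"
    using assms by (intro sum_mult_ge_1[of y]) (auto simp: R_ge_0)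
  thus ?thesis using prod_R_R[of x z] R_01[of x z] assms by auto
qed

text \<open>As \<open>S\<close> squares to \<open>2*v\<close> times \<open>R\<close>, two points
  outside the class of \<open>y\<close> share a class, so there are at most two classes.\<close>

lemma S_S_imp_R:
  assumes "x < n" "y < n" "z < n" "R x y = 0" "R y z = 0"
  shows "R x z = 1"
proof -
  have "0 \<le> 1 - R u w" if "u < n" "w < n" for u w using R_01[OF that] by auto
  hence "1 \<le> (\<Sum>w<n. S x w * S w z)"
    using assms by (intro sum_mult_ge_1[of y]) (auto simp: S_eq)
  thus ?thesis using prod_S_S[of x z] R_01[of x z] assms by auto
qed

section \<open>The involution given by A_1\<close>

definition opp where "opp x = (SOME y. y < n \<and> a 1 x y = 1)"

text \<open>The diagonal entry 1 of A_1^2 = I forces a nonzero term, which gives a candidate for the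
  choice.\<close>

lemma opp:
  assumes "x < n"
  shows "opp x < n" "a 1 x (opp x) = 1"
proof -
  have "(\<Sum>z<n. a 1 x z * a 1 z x) \<noteq> 0"
    using prod_1_1[of x x] assms by (simp add: identity)
  then obtain z where "z < n" "a 1 x z \<noteq> 0" by (rule sum_mult_ne_0D)
  hence "z < n \<and> a 1 x z = 1" using a_01[of 1 x z] assms by auto
  from someI[of "\<lambda>y. y < n \<and> a 1 x y = 1", OF this]
  show "opp x < n" "a 1 x (opp x) = 1" by (simp_all add: opp_def)
qed

lemma a1_eq:
  assumes "x < n" "y < n"
  shows "a 1 x y = of_bool (y = opp x)"
proof -
  have "y = opp x" if "a 1 x y = 1"
  proof -
    \<comment> \<open>The walk from \<open>y\<close> over \<open>x\<close> to \<open>opp x\<close>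
      contributes to A_1^2 = I, so its ends coincide.\<close>
    have "1 \<le> (\<Sum>z<n. a 1 y z * a 1 z (opp x))"
      using assms opp[of x] sym[of 1 x y] that
      by (intro sum_mult_ge_1[of x]) (auto simp: a_ge_0)
    thus ?thesis using prod_1_1[of y "opp x"] assms opp[of x] identity[of y "opp x"]
      by (auto simp: of_bool_def split: if_splits)
  qed
  thus ?thesis
    using a_01[of 1 x y] opp(2)[OF assms(1)] assms by (cases "y = opp x") (simp, auto)
qed

lemma sum_a1:
  assumes "x < n"
  shows "(\<Sum>z<n. a 1 x z * f z) = f (opp x)"
proof -
  have "(\<Sum>z<n. a 1 x z * f z) = (\<Sum>z<n. if z = opp x then f z else 0)"
  proof (rule sum.cong)
    fix z assume "z \<in> {..<n}"
    thus "a 1 x z * f z = (if z = opp x then f z else 0)"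
      using a1_eq[OF assms, of z] by (cases "z = opp x") auto
  qed simp
  thus ?thesis using opp(1)[OF assms] by simp
qed

lemma opp_opp [simp]:
  assumes "x < n"
  shows "opp (opp x) = x"
proof (rule ccontr)
  assume "opp (opp x) \<noteq> x"
  hence "a 1 (opp x) x = 0"
    using a1_eq[OF opp(1)[OF assms] assms] by (metis of_bool_eq(1))
  thus False using sym[of 1 x "opp x"] opp[of x] assms by simp
qed

lemma opp_neq: "x < n \<Longrightarrow> opp x \<noteq> x"
proof
  assume "x < n" "opp x = x"
  hence "a 0 x x = 1" "a 1 x x = 1" using opp[of x] identity[of x x] by simp_all
  thus False
    using R_plus_S[of x x] entries_nonneg[of x x] \<open>x < n\<close> unfolding R_def S_def by linarith
qed

lemma a2_opp: "x < n \<Longrightarrow> y < n \<Longrightarrow> a 2 (opp x) y = a 2 x y"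
  using prod_1_2[of x y] by (simp add: sum_a1[of x "\<lambda>z. a 2 z y"] del: One_nat_def)

lemma a4_opp: "x < n \<Longrightarrow> y < n \<Longrightarrow> a 4 (opp x) y = a 4 x y"
  using prod_1_4[of x y] by (simp add: sum_a1[of x "\<lambda>z. a 4 z y"] del: One_nat_def)

lemma R_opp: "x < n \<Longrightarrow> y < n \<Longrightarrow> R (opp x) y = R x y"
  using prod_1_R[of x y] by (simp add: sum_a1[of x "\<lambda>z. R z y"] del: One_nat_def)

lemma M_opp: "x < n \<Longrightarrow> y < n \<Longrightarrow> M (opp x) y = - M x y"
  using prod_1_M[of x y] by (simp add: sum_a1[of x "\<lambda>z. M z y"] del: One_nat_def)

lemma N_opp: "x < n \<Longrightarrow> y < n \<Longrightarrow> N (opp x) y = N x y"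
  using prod_1_N[of x y] by (simp add: sum_a1[of x "\<lambda>z. N z y"] del: One_nat_def)

lemma R_opp_right: "x < n \<Longrightarrow> y < n \<Longrightarrow> R x (opp y) = R x y"
  using R_opp[of y x] R_sym[of x y] R_sym[of x "opp y"] opp(1)[of y] by simp

section \<open>The matching of pairs given by A_4\<close>

definition mate where "mate x = (SOME y. y < n \<and> a 4 x y = 1)"

lemma mate:
  assumes "x < n"
  shows "mate x < n" "a 4 x (mate x) = 1"
proof -
  have "(\<Sum>z<n. a 4 x z * a 4 z x) \<noteq> 0"
    using prod_4_4[of x x] assms entries_nonneg[of x x] by (simp add: identity)
  then obtain z where "z < n" "a 4 x z \<noteq> 0" by (rule sum_mult_ne_0D)
  hence "z < n \<and> a 4 x z = 1" using a_01[of 4 x z] assms by auto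
  from someI[of "\<lambda>y. y < n \<and> a 4 x y = 1", OF this]
  show "mate x < n" "a 4 x (mate x) = 1" by (simp_all add: mate_def)
qed

text \<open>Two A_4-neighbours of \<open>x\<close> give a positive entry of A_4^2 = 2(I + A_1), so
  they are equal or partners.\<close>

lemma a4_unique:
  assumes "x < n" "y < n" "z < n" "a 4 x y = 1" "a 4 x z = 1"
  shows "z = y \<or> z = opp y"
proof -
  have "1 \<le> (\<Sum>w<n. a 4 y w * a 4 w z)"
    using assms sym[of 4 x y] by (intro sum_mult_ge_1[of x]) (auto simp: a_ge_0)
  thus ?thesis
    using prod_4_4[of y z] identity[of y z] a1_eq[of y z] assms by (auto simp: of_bool_def split: if_splits)
qed

lemma a4_opp_right: "x < n \<Longrightarrow> y < n \<Longrightarrow> a 4 x (opp y) = a 4 x y"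
  using a4_opp[of y x] sym[of 4 x y] sym[of 4 x "opp y"] opp(1)[of y] by simp

lemma a4_eq:
  assumes "x < n" "z < n"
  shows "a 4 x z = of_bool (z = mate x \<or> z = opp (mate x))"
  using a4_unique[of x "mate x" z] mate[of x] opp[of "mate x"] a4_opp_right[of x "mate x"]
    a_01[of 4 x z] assms by auto

text \<open>Row \<open>x\<close> of A_4 is supported on \<open>mate x\<close> and its partner, where
  \<open>N\<close> has equal rows. So the factor 2 cancels from A_4 N = 2 A_2.\<close>

lemma N_mate:
  assumes "x < n" "y < n"
  shows "N (mate x) y = a 2 x y"
proof -
  have "a 4 x z * N z y = (if z = mate x then N z y else 0) + (if z = opp (mate x) then N z y else 0)"
    if "z < n" for z
    using a4_eq[OF assms(1) that] opp_neq[of "mate x"] mate(1)[OF assms(1)] by auto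
  hence "(\<Sum>z<n. a 4 x z * N z y) = N (mate x) y + N (opp (mate x)) y"
    using mate(1)[OF assms(1)] opp(1)[of "mate x"] by (simp add: sum.distrib)
  thus ?thesis using prod_4_N[OF assms] N_opp[of "mate x" y] mate(1)[OF assms(1)] assms by simp
qed

section \<open>Pair representatives and sums over each half\<close>

definition Xp where "Xp = {x. x < n \<and> R x0 x = 1}"
definition Xm where "Xm = {x. x < n \<and> R x0 x = 0}"

text \<open>Comparing indices is an arbitrary way to select one point of each pair in the half of
  \<open>x0\<close>.\<close>

definition U where "U = {x \<in> Xp. x < opp x}"

lemma UD: "x \<in> U \<Longrightarrow> x < n \<and> R x0 x = 1 \<and> x < opp x"
  by (simp add: U_def Xp_def)

lemma finite_U [simp]: "finite U"
  by (rule finite_subset[of _ "{..<n}"]) (auto dest: UD)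

lemma opp_Xp: "x \<in> Xp \<Longrightarrow> opp x \<in> Xp"
  using opp(1) R_opp_right base by (auto simp: Xp_def)

lemma R_Xp: "x \<in> Xp \<Longrightarrow> z < n \<Longrightarrow> R x z = 1 \<longleftrightarrow> z \<in> Xp"
  using R_trans[of x0 x z] R_trans[of x x0 z] R_sym[of x0 x] base by (auto simp: Xp_def)

lemma sum_Xp:
  fixes g :: "nat \<Rightarrow> real"
  assumes "\<And>x. x < n \<Longrightarrow> g (opp x) = g x"
  shows "sum g Xp = 2 * sum g U"
proof -
  have Xp: "Xp = U \<union> opp ` U"
  proof (intro equalityI subsetI)
    fix x assume x: "x \<in> Xp"
    hence "x < n" by (simp add: Xp_def)
    hence "x < opp x \<or> opp x < opp (opp x)" using opp_neq[of x] by auto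
    thus "x \<in> U \<union> opp ` U"
    proof
      assume "opp x < opp (opp x)"
      hence "opp x \<in> U" using opp_Xp[OF x] by (simp add: U_def)
      hence "opp (opp x) \<in> opp ` U" by blast
      thus ?thesis using \<open>x < n\<close> by simp
    qed (use x in \<open>simp add: U_def\<close>)
  qed (use opp_Xp in \<open>auto simp: U_def\<close>)
  have disj: "U \<inter> opp ` U = {}"
  proof -
    have False if "x \<in> U" "opp x \<in> U" for x
      using that by (auto dest!: UD)
    thus ?thesis by blast
  qed
  have inj: "inj_on opp U"
    by (rule inj_on_inverseI[of _ opp]) (auto dest: UD)
  have "sum g Xp = sum g U + sum g (opp ` U)"
    unfolding Xp by (rule sum.union_disjoint) (use disj in auto)
  also have "sum g (opp ` U) = sum g U"
    unfolding sum.reindex[OF inj] by (rule sum.cong) (auto dest!: UD simp: assms)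
  finally show ?thesis by simp
qed

text \<open>Both are A_4-neighbours of \<open>z\<close>, hence equal or partners, and
  \<open>U\<close> contains only one of two partners.\<close>

lemma mate_common:
  assumes "u \<in> U" "w \<in> U" "z < n" "a 4 u z = 1" "a 4 w z = 1"
  shows "u = w"
proof -
  have "w = u \<or> w = opp u"
    using assms UD[of u] UD[of w] sym[of 4 _ z] by (intro a4_unique[of z]) auto
  thus ?thesis using UD[OF assms(1)] UD[OF assms(2)] by auto
qed

lemma a4_Xm:
  assumes "u \<in> Xp" "z < n" "a 4 u z = 1"
  shows "z \<in> Xm"
proof -
  have u: "u < n" "R x0 u = 1" using assms(1) by (auto simp: Xp_def)
  have "R x0 z \<noteq> 1"
    using R_eq_1D(1)[of u z] R_Xp[OF assms(1,2)] assms u by (auto simp: Xp_def)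
  thus ?thesis using R_01[of x0 z] base assms by (auto simp: Xm_def)
qed

lemma Xm_mate: "Xm = mate ` U \<union> (\<lambda>u. opp (mate u)) ` U"
proof (intro equalityI subsetI)
  fix z assume "z \<in> Xm"
  hence z: "z < n" "R x0 z = 0" by (auto simp: Xm_def)
  \<comment> \<open>The A_4-neighbour of \<open>z\<close> lies in the half of \<open>x0\<close>. It
    or its partner is a representative, and both are A_4-adjacent to \<open>z\<close>.\<close>
  define x where "x = mate z"
  have x: "x < n" "a 4 x z = 1"
    using mate[of z] sym[of 4 z x] z by (auto simp: x_def)
  have "R x z = 0" using R_eq_1D(1)[of x z] R_01[of x z] x z by auto
  hence "R x0 x = 1" using S_S_imp_R[of x0 z x] R_sym[of x z] base x z by auto
  hence "x \<in> Xp" using x by (simp add: Xp_def)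
  moreover have "x < opp x \<or> opp x < opp (opp x)" using opp_neq[of x] x by auto
  ultimately have "x \<in> U \<or> opp x \<in> U" using opp_Xp[of x] by (auto simp: U_def)
  then obtain u where u: "u \<in> U" "a 4 u z = 1" using x z a4_opp[of x z] by auto
  thus "z \<in> mate ` U \<union> (\<lambda>u. opp (mate u)) ` U"
    using a4_eq[of u z] UD[of u] z by (auto simp: of_bool_def split: if_splits)
next
  fix z assume "z \<in> mate ` U \<union> (\<lambda>u. opp (mate u)) ` U"
  then obtain u where u: "u \<in> U" "z = mate u \<or> z = opp (mate u)" by auto
  have "u < n" using UD[OF u(1)] by simp
  hence "z < n" "a 4 u z = 1" using u(2) mate[of u] opp[of "mate u"] a4_eq[of u z] by auto
  thus "z \<in> Xm" using a4_Xm[of u z] u(1) by (simp add: U_def)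
qed

text \<open>The mates of representatives and their partners exhaust \<open>Xm\<close> without
  repetition, since \<open>mate_common\<close> recovers the representative.\<close>

lemma sum_Xm:
  fixes g :: "nat \<Rightarrow> real"
  assumes "\<And>x. x < n \<Longrightarrow> g (opp x) = g x"
  shows "sum g Xm = 2 * (\<Sum>u\<in>U. g (mate u))"
proof -
  have m: "mate u < n" "opp (mate u) < n" "a 4 u (mate u) = 1" "a 4 u (opp (mate u)) = 1"
    if "u \<in> U" for u
    using UD[OF that] mate[of u] opp[of "mate u"] a4_opp_right[of u "mate u"] by auto
  have inj1: "inj_on mate U"
    by (rule inj_onI) (metis m mate_common)
  have inj2: "inj_on (\<lambda>u. opp (mate u)) U"
    by (rule inj_onI) (metis m mate_common)
  have disj: "mate ` U \<inter> (\<lambda>u. opp (mate u)) ` U = {}"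
  proof -
    have False if "u \<in> U" "w \<in> U" "mate u = opp (mate w)" for u w
    proof -
      have "u = w" using that m mate_common by metis
      thus False using that opp_neq[of "mate w"] m(1)[of w] by simp
    qed
    thus ?thesis by blast
  qed
  have "sum g Xm = sum g (mate ` U) + sum g ((\<lambda>u. opp (mate u)) ` U)"
    unfolding Xm_mate by (rule sum.union_disjoint) (use disj in auto)
  also have "sum g (mate ` U) = (\<Sum>u\<in>U. g (mate u))" by (simp add: sum.reindex[OF inj1])
  also have "sum g ((\<lambda>u. opp (mate u)) ` U) = (\<Sum>u\<in>U. g (mate u))"
    unfolding sum.reindex[OF inj2] by (rule sum.cong) (auto simp: assms m)
  finally show ?thesis by simp
qed

section \<open>Counting and integrality\<close>

lemma card_U: "real (card U) = v"
proof -
  \<comment> \<open>The diagonal entry of R^2 counts the points in the half of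
    \<open>x0\<close>.\<close>
  have "2 * v = (\<Sum>z<n. R x0 z * R z x0)" using prod_R_R[of x0 x0] base R_refl by simp
  also have "\<dots> = (\<Sum>z<n. if R x0 z = 1 then 1 else 0)"
  proof (rule sum.cong)
    fix z assume "z \<in> {..<n}"
    thus "R x0 z * R z x0 = (if R x0 z = 1 then 1 else 0)"
      using R_01[of x0 z] R_sym[of x0 z] base by auto
  qed simp
  also have "\<dots> = (\<Sum>z\<in>Xp. 1)"
    by (simp add: sum.If_cases Xp_def Int_def lessThan_def)
  also have "\<dots> = 2 * (\<Sum>u\<in>U. 1)" by (rule sum_Xp) simp
  finally show ?thesis by simp
qed

text \<open>A_2 vanishes between the halves and is constant on pairs, so summing over
  \<open>U\<close> halves the formula for A_2^2.\<close>

lemma sum_a2_U: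
  assumes "x \<in> Xp" "y < n"
  shows "(\<Sum>u\<in>U. a 2 x u * a 2 u y) = k * (a 0 x y + a 1 x y) + l * a 2 x y + m * a 3 x y"
proof -
  have x: "x < n" using assms(1) by (simp add: Xp_def)
  have opp_r: "a 2 x (opp z) = a 2 x z" if "z < n" for z
    using a2_opp[of z x] sym[of 2 x z] sym[of 2 x "opp z"] opp(1)[of z] x that by simp
  have "(\<Sum>z<n. a 2 x z * a 2 z y) = (\<Sum>z\<in>Xp. a 2 x z * a 2 z y)"
  proof (rule sum.mono_neutral_right)
    show "\<forall>z\<in>{..<n} - Xp. a 2 x z * a 2 z y = 0"
      using R_Xp[OF assms(1)] R_01[OF x] R_eq_0D[OF x] by auto
  qed (auto simp: Xp_def)
  also have "\<dots> = 2 * (\<Sum>u\<in>U. a 2 x u * a 2 u y)"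
    by (rule sum_Xp) (use assms a2_opp opp_r in auto)
  finally show ?thesis using prod_2_2[OF x assms(2)] by simp
qed

lemma sum_a2_U_Nats:
  assumes "x < n" "y < n"
  shows "(\<Sum>u\<in>U. a 2 x u * a 2 u y) \<in> \<nat>"
proof -
  have "a 2 x u * a 2 u y = of_bool (a 2 x u = 1 \<and> a 2 u y = 1)" if "u \<in> U" for u
    using a_01[of 2 x u] a_01[of 2 u y] assms UD[OF that] by auto
  hence "(\<Sum>u\<in>U. a 2 x u * a 2 u y) = real (\<Sum>u\<in>U. of_bool (a 2 x u = 1 \<and> a 2 u y = 1))"
    by (simp only: of_nat_sum of_nat_of_bool cong: sum.cong)
  thus ?thesis by (simp only: of_nat_in_Nats)
qed

lemma a_disjoint:
  assumes "i \<le> 7" "x < n" "y < n" "a i x y = 1" "j \<le> 7" "j \<noteq> i"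
  shows "a j x y = 0"
proof -
  have "(\<Sum>h\<le>7. a h x y) = a i x y + (a j x y + sum (\<lambda>h. a h x y) ({..7} - {i} - {j}))"
    using assms by (subst sum.remove[of _ i], simp_all, subst sum.remove[of _ j], simp_all)
  moreover have "sum (\<lambda>h. a h x y) ({..7} - {i} - {j}) \<ge> 0"
    using assms by (intro sum_nonneg) (auto simp: a_ge_0)
  ultimately show ?thesis
    using sum_entries[of x y] a_ge_0[of j x y] assms by simp
qed

lemma x0_Xp: "x0 \<in> Xp"
  using base R_refl by (simp add: Xp_def)

text \<open>At a diagonal entry only A_0 survives in \<open>sum_a2_U\<close>, which equates k with a
  count. Entries of A_3 and A_2 do the same for \<open>m\<close> and \<open>l\<close>.\<close>

lemma k_Nats: "k \<in> \<nat>"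
  using sum_a2_U[OF x0_Xp base(1)] sum_a2_U_Nats[of x0 x0] identity[of x0 x0] base
    a_disjoint[of 0 x0 x0 1] a_disjoint[of 0 x0 x0 2] a_disjoint[of 0 x0 x0 3] by simp

lemma m_Nats: "m \<in> \<nat>"
  using sum_a2_U[OF x0_Xp base(2)] sum_a2_U_Nats[of x0 y0] base
    a_disjoint[of 3 x0 y0 1] a_disjoint[of 3 x0 y0 2] a_disjoint[of 3 x0 y0 0] by simp

lemma l_Nats: "l \<in> \<nat>"
proof -
  \<comment> \<open>The diagonal of A_2^2 is 2k > 0, so row \<open>x0\<close> of A_2 has a nonzero
    entry.\<close>
  have "(\<Sum>z<n. a 2 x0 z * a 2 z x0) \<noteq> 0"
    using prod_2_2[of x0 x0] k_pos identity[of x0 x0] base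
      a_disjoint[of 0 x0 x0 1] a_disjoint[of 0 x0 x0 2] a_disjoint[of 0 x0 x0 3] by simp
  then obtain z where "z < n" "a 2 x0 z \<noteq> 0" by (rule sum_mult_ne_0D)
  moreover from this have "a 2 x0 z = 1" using a_01[of 2 x0 z] base by auto
  ultimately show ?thesis
    using sum_a2_U[OF x0_Xp, of z] sum_a2_U_Nats[of x0 z] base
      a_disjoint[of 2 x0 z 1] a_disjoint[of 2 x0 z 0] a_disjoint[of 2 x0 z 3] by simp
qed

section \<open>The weighing matrix and its strongly regular graph\<close>

lemma sum_M_mate:
  assumes "x \<in> U" "y \<in> U"
  shows "(\<Sum>u\<in>U. M x (mate u) * M y (mate u)) = (if x = y then k else 0)"
proof -
  have xy: "x < n" "y < n" "x \<in> Xp" "x < opp x" "y < opp y"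
    using UD[of x] UD[of y] assms by (auto simp: U_def)
  have opp_r: "M w (opp z) = - M w z" if "z < n" "w < n" for w z
    using M_opp[of z w] M_sym[of w z] M_sym[of w "opp z"] opp(1)[of z] that by simp
  have "2 * k * (a 0 x y - a 1 x y) = (\<Sum>z<n. M x z * M z y)" using prod_M_M[OF xy(1,2)] by simp
  also have "\<dots> = (\<Sum>z<n. M x z * M y z)"
    using M_sym xy by (intro sum.cong) auto
  also have "\<dots> = (\<Sum>z\<in>Xm. M x z * M y z)"
  proof (rule sum.mono_neutral_right)
    show "\<forall>z\<in>{..<n} - Xm. M x z * M y z = 0"
    proof
      fix z assume "z \<in> {..<n} - Xm"
      hence "z < n" "z \<in> Xp" using R_01[OF base(1), of z] by (auto simp: Xm_def Xp_def)
      thus "M x z * M y z = 0" using R_Xp[OF xy(3)] R_eq_1D(2)[OF xy(1)] by auto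
    qed
  qed (auto simp: Xm_def)
  \<comment> \<open>Passing from \<open>z\<close> to its partner negates both factors, so the
    summand is constant on pairs.\<close>
  also have "\<dots> = 2 * (\<Sum>u\<in>U. M x (mate u) * M y (mate u))"
    by (rule sum_Xm) (use xy opp_r in auto)
  finally show ?thesis
    using identity[of x y] a1_eq[of x y] xy by (auto simp: of_bool_def split: if_splits)
qed

lemma abs_M_mate:
  assumes "x \<in> U" "y \<in> U"
  shows "\<bar>M x (mate y)\<bar> = a 2 x y"
  using abs_M[of x "mate y"] N_sym[of x "mate y"] N_mate[of y x] sym[of 2 x y]
    mate(1)[of y] UD[of x] UD[of y] assms by simp

lemma sum_a2_U_srg:
  assumes "x \<in> U" "y \<in> U"
  shows "(\<Sum>u\<in>U. a 2 x u * a 2 u y)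
       = k * of_bool (x = y) + l * a 2 x y + m * (1 - of_bool (x = y) - a 2 x y)"
proof -
  have xy: "x < n" "y < n" "x \<in> Xp" "y \<in> Xp" using UD assms by (auto simp: U_def)
  \<comment> \<open>Two representatives are never partners. Within the half this leaves A_0, A_2 and
    A_3, so A_3 acts as J - I - A_2.\<close>
  have "a 1 x y = 0" using a1_eq[OF xy(1,2)] UD[OF assms(1)] UD[OF assms(2)] by auto
  moreover have "R x y = 1" using R_Xp[OF xy(3,2)] xy(4) by simp
  ultimately have "a 3 x y = 1 - of_bool (x = y) - a 2 x y"
    using identity[OF xy(1,2)] by (simp add: R_def)
  thus ?thesis
    using sum_a2_U[OF xy(3,2)] \<open>a 1 x y = 0\<close> identity[OF xy(1,2)] by simp
qed

lemma ex_weighing_matrix: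
  "\<exists>(w :: nat) (k' :: nat) (l' :: nat) (m' :: nat) W G.
     real w = v \<and> real k' = k \<and> real l' = l \<and> real m' = m \<and>
     weighing_matrix w k' W \<and> quasi_balanced w W \<and>
     strongly_regular G w k' l' m' \<and> abs_mat W = adjacency_mat w G"
proof -
  define w where "w = card U"
  obtain e where "bij_betw e {0..<w} U"
    using ex_bij_betw_nat_finite[OF finite_U] w_def by blast
  hence e: "bij_betw e {..<w} U" by (simp add: lessThan_atLeast0)
  have eU: "e i \<in> U" if "i < w" for i using e that by (auto simp: bij_betw_def)
  have e_eq: "e i = e j \<longleftrightarrow> i = j" if "i < w" "j < w" for i j
    using e that by (auto simp: bij_betw_def inj_on_eq_iff)
  have e_n: "e i < n" if "i < w" for i using UD[OF eU[OF that]] by simp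
  obtain k' l' m' where klm: "k = real k'" "l = real l'" "m = real m'"
    using k_Nats l_Nats m_Nats by (metis Nats_cases)
  \<comment> \<open>Rows are the representatives, columns their mates. The floor only converts the
    entries -1, 0, 1 to integers.\<close>
  define W where "W = mat w w (\<lambda>(i, j). \<lfloor>M (e i) (mate (e j))\<rfloor>)"
  define G where "G = {{i, j} | i j. i < w \<and> j < w \<and> i \<noteq> j \<and> a 2 (e i) (e j) = 1}"
  define B where "B = adjacency_mat w G"
  have W_carr: "W \<in> carrier_mat w w" and B_carr: "B \<in> carrier_mat w w"
    by (simp_all add: W_def B_def adjacency_mat_def)
  have W: "real_of_int (W $$ (i, j)) = M (e i) (mate (e j))" if "i < w" "j < w" for i j
  proof -
    have "M (e i) (mate (e j)) = - 1 \<or> M (e i) (mate (e j)) = 0 \<or> M (e i) (mate (e j)) = 1"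
      using M_cases[of "e i" "mate (e j)"] e_n mate(1)[of "e j"] that by blast
    thus ?thesis using that by (elim disjE) (simp_all add: W_def)
  qed
  \<comment> \<open>\<open>G\<close> has no loops by construction, so matching it with A_2 on the
    diagonal requires A_2 to vanish there.\<close>
  have a2_diag: "a 2 (e i) (e i) = 0" if "i < w" for i
    using a_disjoint[of 0 "e i" "e i" 2] identity[of "e i" "e i"] e_n[OF that] by simp
  have "{i, j} \<in> G \<longleftrightarrow> a 2 (e i) (e j) = 1" if "i < w" "j < w" for i j
  proof
    assume "{i, j} \<in> G"
    thus "a 2 (e i) (e j) = 1"
      using sym[of 2 "e i" "e j"] e_n that by (auto simp: G_def doubleton_eq_iff)
  next
    assume *: "a 2 (e i) (e j) = 1"
    hence "i \<noteq> j" using a2_diag[OF that(1)] by auto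
    thus "{i, j} \<in> G" using * that unfolding G_def by blast
  qed
  hence B: "real_of_int (B $$ (i, j)) = a 2 (e i) (e j)" if "i < w" "j < w" for i j
    using that a_01[of 2 "e i" "e j"] e_n[of i] e_n[of j] by (auto simp: B_def adjacency_mat_def)
  have abs_W: "abs_mat W = B"
  proof (rule eq_matI)
    fix i j assume "i < dim_row B" "j < dim_col B"
    hence ij: "i < w" "j < w" using B_carr by auto
    \<comment> \<open>Integer equalities are proved after embedding into the reals, where the scheme
      entries live.\<close>
    have "real_of_int \<bar>W $$ (i, j)\<bar> = real_of_int (B $$ (i, j))"
      using W[OF ij] B[OF ij] abs_M_mate[OF eU eU] ij by simp
    thus "abs_mat W $$ (i, j) = B $$ (i, j)"
      using W_carr ij unfolding abs_mat_def by (simp only: of_int_eq_iff) simp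
  qed (use W_carr B_carr in \<open>auto simp: abs_mat_def\<close>)
  have BT: "B\<^sup>T = B"
    using B_carr by (intro eq_matI) (auto simp: B_def adjacency_mat_def insert_commute)
  have BB: "real_of_int ((B * B) $$ (i, j)) =
      real k' * of_bool (i = j) + real l' * real_of_int (B $$ (i, j))
        + real m' * (1 - of_bool (i = j) - real_of_int (B $$ (i, j)))" if ij: "i < w" "j < w" for i j
  proof -
    have "real_of_int ((B * B\<^sup>T) $$ (i, j)) = (\<Sum>q<w. a 2 (e i) (e q) * a 2 (e j) (e q))"
      using ij by (simp add: mult_transpose_index[OF B_carr B_carr] B)
    also have "\<dots> = (\<Sum>u\<in>U. a 2 (e i) u * a 2 (e j) u)"
      by (rule sum.reindex_bij_betw[OF e])
    also have "\<dots> = (\<Sum>u\<in>U. a 2 (e i) u * a 2 u (e j))"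
      using sym[of 2 "e j"] e_n[OF ij(2)] UD by (intro sum.cong) auto
    finally show ?thesis
      using sum_a2_U_srg[OF eU eU, OF ij] e_eq[OF ij] B[OF ij] BT klm by simp
  qed
  have weigh: "weighing_matrix w k' W"
    unfolding weighing_matrix_def
  proof (intro conjI W_carr)
    have "W $$ (i, j) \<in> {0, 1, -1}" if "i < w" "j < w" for i j
    proof -
      have "real_of_int (W $$ (i, j)) \<in> {real_of_int 0, real_of_int 1, real_of_int (- 1)}"
        using W[OF that] M_cases[of "e i" "mate (e j)"] e_n mate(1)[of "e j"] that by auto
      thus ?thesis by (simp only: insert_iff of_int_eq_iff empty_iff)
    qed
    thus "elements_mat W \<subseteq> {0, 1, -1}" using W_carr by (fastforce dest: elements_matD)
    show "W * W\<^sup>T = int k' \<cdot>\<^sub>m 1\<^sub>m w"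
    proof (rule eq_matI)
      fix i j assume "i < dim_row (int k' \<cdot>\<^sub>m 1\<^sub>m w)" "j < dim_col (int k' \<cdot>\<^sub>m 1\<^sub>m w)"
      hence ij: "i < w" "j < w" by auto
      have "real_of_int ((W * W\<^sup>T) $$ (i, j))
          = (\<Sum>q<w. M (e i) (mate (e q)) * M (e j) (mate (e q)))"
        using ij by (simp add: mult_transpose_index[OF W_carr W_carr] W)
      also have "\<dots> = (\<Sum>u\<in>U. M (e i) (mate u) * M (e j) (mate u))"
        by (rule sum.reindex_bij_betw[OF e])
      also have "\<dots> = real_of_int ((int k' \<cdot>\<^sub>m 1\<^sub>m w) $$ (i, j))"
        using sum_M_mate[OF eU eU, OF ij] e_eq[OF ij] ij klm by simp
      finally show "(W * W\<^sup>T) $$ (i, j) = (int k' \<cdot>\<^sub>m 1\<^sub>m w) $$ (i, j)"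
        by (simp only: of_int_eq_iff)
    qed (use W_carr in auto)
  qed
  have "quasi_balanced w W"
    unfolding quasi_balanced_def abs_W BT
  proof (intro conjI refl)
    \<comment> \<open>Off the diagonal the entry is \<open>l'\<close> or \<open>m'\<close> according
      to whether \<open>B\<close> has entry 1 or 0 there.\<close>
    have "(B * B) $$ (i, j) \<in> {int l', int m'}" if ij: "i < w" "j < w" "i \<noteq> j" for i j
    proof -
      have "real_of_int ((B * B) $$ (i, j)) \<in> {real_of_int (int l'), real_of_int (int m')}"
        using BB[OF ij(1,2)] B[OF ij(1,2)] a_01[of 2 "e i" "e j"] e_n[OF ij(1)] e_n[OF ij(2)] ij(3)
        by auto
      thus ?thesis by (simp only: insert_iff of_int_eq_iff empty_iff)
    qed
    hence "card {(B * B) $$ (i, j) | i j. i < w \<and> j < w \<and> i \<noteq> j} \<le> card {int l', int m'}"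
      by (intro card_mono) auto
    also have "\<dots> \<le> 2" by (simp add: card_insert_if)
    finally show "card {(B * B) $$ (i, j) | i j. i < w \<and> j < w \<and> i \<noteq> j} \<le> 2" .
  qed
  moreover have "strongly_regular G w k' l' m'"
    unfolding strongly_regular_def Let_def B_def[symmetric]
  proof (intro conjI)
    show "simple_graph w G" by (auto simp: simple_graph_def G_def)
    let ?C = "int k' \<cdot>\<^sub>m 1\<^sub>m w + int l' \<cdot>\<^sub>m B + int m' \<cdot>\<^sub>m (all_ones_mat w - 1\<^sub>m w - B)"
    show "B * B = ?C"
    proof (rule eq_matI)
      fix i j assume "i < dim_row ?C" "j < dim_col ?C"
      hence ij: "i < w" "j < w" using B_carr by auto
      have "real_of_int ((B * B) $$ (i, j)) = real_of_int (?C $$ (i, j))"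
        using BB[OF ij] ij B_carr by (simp add: all_ones_mat_def del: index_mult_mat)
      thus "(B * B) $$ (i, j) = ?C $$ (i, j)" by (simp only: of_int_eq_iff)
    qed (use B_carr in auto)
  qed
  moreover have "real w = v" using card_U by (simp add: w_def)
  ultimately show ?thesis using weigh abs_W klm unfolding B_def by metis
qed

end

section \<open>From complex matrices to real entries\<close>

lemma fourfold_schemeI:
  assumes "k > 0" "k + s * t \<noteq> 0"
    and sch: "symmetric_association_scheme n 7 A"
    and ord: "primitive_idempotents_ordering n 7 A E"
    and P: "first_eigenmatrix n 7 A E (map_mat complex_of_real (P_mat k s t))"
    and base: "x0 < n" "y0 < n" "A 3 $$ (x0, y0) = 1"
  shows "fourfold_scheme n k s t (\<lambda>i x y. Re (A i $$ (x, y))) x0 y0"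
proof
  have carr: "A i \<in> carrier_mat n n" if "i \<le> 7" for i
    using scheme_carrier[OF sch that] .
  have val: "A i $$ (x, y) \<in> {0, 1}" if "i \<le> 7" "x < n" "y < n" for i x y
    using sch that elements_matI[OF carr, of i x y "A i $$ (x, y)"]
    unfolding symmetric_association_scheme_def by blast
  \<comment> \<open>All entries are 0 or 1, so taking real parts loses nothing.\<close>
  have of_real: "complex_of_real (Re (A i $$ (x, y))) = A i $$ (x, y)"
    if "i \<le> 7" "x < n" "y < n" for i x y
    using val[OF that] by auto
  show "Re (A i $$ (x, y)) \<in> {0, 1}" if "i \<le> 7" "x < n" "y < n" for i x y
    using val[OF that] by auto
  show "(\<Sum>i\<le>7. Re (A i $$ (x, y))) = 1" if "x < n" "y < n" for x y
  proof -
    have "lincomb_mat n 7 (\<lambda>_. 1) A $$ (x, y) = all_ones_mat n $$ (x, y)"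
      using sch by (simp add: symmetric_association_scheme_def)
    hence "(\<Sum>i\<le>7. A i $$ (x, y)) = 1"
      using that by (simp add: lincomb_mat_index all_ones_mat_def)
    thus ?thesis by (metis Re_sum one_complex.simps(1))
  qed
  show "Re (A 0 $$ (x, y)) = of_bool (x = y)" if "x < n" "y < n" for x y
    using sch that by (simp add: symmetric_association_scheme_def)
  show "Re (A i $$ (x, y)) = Re (A i $$ (y, x))" if "i \<le> 7" "x < n" "y < n" for i x y
  proof -
    have "(A i)\<^sup>T = A i" using sch that(1) by (simp add: symmetric_association_scheme_def)
    thus ?thesis
      using index_transpose_mat(1)[of y "A i" x] carr[OF that(1)] that(2,3) by auto
  qed
  show "(\<Sum>z<n. (\<Sum>i\<le>7. b i * Re (A i $$ (x, z))) * (\<Sum>i\<le>7. c i * Re (A i $$ (z, y))))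
      = (\<Sum>i\<le>7. g i * Re (A i $$ (x, y)))"
    if eq: "\<And>i. i \<le> 7 \<Longrightarrow>
        (\<Sum>j\<le>7. b j * P_mat k s t $$ (i, j)) * (\<Sum>j\<le>7. c j * P_mat k s t $$ (i, j))
          = (\<Sum>j\<le>7. g j * P_mat k s t $$ (i, j))" and xy: "x < n" "y < n" for b c g x y
  proof -
    have dims: "dim_row (P_mat k s t) = 8" "dim_col (P_mat k s t) = 8"
      by (simp_all add: P_mat_def mat_of_rows_list_def)
    have row: "(\<Sum>j\<le>7. complex_of_real (h j) * map_mat complex_of_real (P_mat k s t) $$ (i, j))
        = complex_of_real (\<Sum>j\<le>7. h j * P_mat k s t $$ (i, j))" if "i \<le> 7" for i h
      using that by (simp add: dims)
    have lin: "lincomb_mat n 7 (\<lambda>j. complex_of_real (h j)) A $$ (x, y)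
        = complex_of_real (\<Sum>i\<le>7. h i * Re (A i $$ (x, y)))" if "x < n" "y < n" for h x y
      using that by (simp add: lincomb_mat_index of_real)
    have "lincomb_mat n 7 (\<lambda>j. complex_of_real (b j)) A * lincomb_mat n 7 (\<lambda>j. complex_of_real (c j)) A
        = lincomb_mat n 7 (\<lambda>j. complex_of_real (g j)) A"
      by (rule lincomb_scheme_mult[OF sch ord P]) (simp only: row eq flip: of_real_mult)
    hence "(\<Sum>z<n. complex_of_real (\<Sum>i\<le>7. b i * Re (A i $$ (x, z)))
              * complex_of_real (\<Sum>i\<le>7. c i * Re (A i $$ (z, y))))
        = complex_of_real (\<Sum>i\<le>7. g i * Re (A i $$ (x, y)))"
      using mat_mult_index[OF lincomb_mat_carrier lincomb_mat_carrier xy,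
          of 7 "\<lambda>j. complex_of_real (b j)" A 7 "\<lambda>j. complex_of_real (c j)" A] xy
      by (simp add: lin del: index_mult_mat of_real_sum)
    thus ?thesis by (simp only: flip: of_real_mult of_real_sum) (simp only: of_real_eq_iff)
  qed
qed (use assms in auto)

theorem theorem4p2:
  fixes k s t :: real
  assumes "k > s" and "s > t" and "k > 0" and "k + s * t \<noteq> 0"
    and "\<exists>n A E. symmetric_association_scheme n 7 A \<and>
           primitive_idempotents_ordering n 7 A E \<and>
           first_eigenmatrix n 7 A E (map_mat complex_of_real (P_mat k s t)) \<and>
           second_eigenmatrix n 7 A E (map_mat complex_of_real (Q_mat k s t))"
  shows "\<exists>(v :: nat) (k' :: nat) (l :: nat) (m :: nat) W G.
           real v = (k - s) * (k - t) / (k + s * t) \<and>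
           real k' = k \<and>
           real l = k + s + t + s * t \<and>
           real m = k + s * t \<and>
           weighing_matrix v k' W \<and> quasi_balanced v W \<and>
           strongly_regular G v k' l m \<and> abs_mat W = adjacency_mat v G"
proof -
  obtain n A E where sch: "symmetric_association_scheme n 7 A"
    and ord: "primitive_idempotents_ordering n 7 A E"
    and P: "first_eigenmatrix n 7 A E (map_mat complex_of_real (P_mat k s t))"
    using assms(5) by blast
  have A3: "A 3 \<in> carrier_mat n n" "A 3 \<noteq> 0\<^sub>m n n" "elements_mat (A 3) \<subseteq> {0, 1}"
    using sch by (auto simp: symmetric_association_scheme_def)
  \<comment> \<open>A nonzero entry of A_3 supplies the base pair: its first point fixes a half, and
    the pair makes k + st a count.\<close>
  have "\<exists>x y. x < n \<and> y < n \<and> A 3 $$ (x, y) \<noteq> 0"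
  proof (rule ccontr)
    assume "\<not> ?thesis"
    hence "A 3 = 0\<^sub>m n n" using A3(1) by (intro eq_matI) auto
    thus False using A3(2) by contradiction
  qed
  then obtain x y where xy: "x < n" "y < n" "A 3 $$ (x, y) \<noteq> 0" by blast
  hence "A 3 $$ (x, y) = 1" using A3(3) elements_matI[OF A3(1) xy(1,2)] by blast
  then interpret fourfold_scheme n k s t "\<lambda>i x y. Re (A i $$ (x, y))" x y
    by (intro fourfold_schemeI[OF assms(3,4) sch ord P] xy)
  show ?thesis using ex_weighing_matrix unfolding v_def .
qed

end
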